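(* Let $X,Y$ be nonempty sets, let $c\colon X\times Y\to\mathbb{R}\cup\{+\infty\}$ be a cost with nonempty domain $D$, and let $G$ be a nonempty subset of $D$ that is $c$-path bounded. Suppose that there is a nonempty finite subset $\Omega$ of $G$ such that for every $(x,y)\in G$ there exists a path in $G$ from $(x,y)$ to some point $(x_e,y_e)\in\Omega$. Then the function $$f\colon G\to[-\infty,+\infty],\qquad f(x,y)=\sup_{(x_e,y_e)\in\Omega}F_G\big((x,y),(x_e,y_e)\big)$$ is a $c$-antiderivative of $G$ (in particular, it is real-valued).
   Context: $D:=\{(x,y)\in X\times Y: c(x,y)<+\infty\}$. Convention: $r-(+\infty)=-\infty$ for $r\in\mathbb{R}$. Path: for a nonempty $G\subseteq D$ and $(x_s,y_s),(x_e,y_e)\in G$, a path in $G$ from $(x_s,y_s)$ to $(x_e,y_e)$ is a finite sequence $((x_k,y_k))_{k=1}^{N+1}$ in $G$ ($N\ge 1$) with $(x_1,y_1)=(x_s,y_s)$, $(x_{N+1},y_{N+1})=(x_e,y_e)$ and $c(x_{k+1},y_k)<+\infty$ for every $k\in\{1,\dots,N\}$. Maximal inner variation: $F_G\big((x_s,y_s),(x_e,y_e)\big):=\sup\sum_{k=1}^N\big(c(x_k,y_k)-c(x_{k+1},y_k)\big)\in[-\infty,+\infty]$, the supremum being over all paths in $G$ from $(x_s,y_s)$ to $(x_e,y_e)$, with $\sup\varnothing=-\infty$. $G$ is $c$-path bounded if $F_G\big((x_s,y_s),(x_e,y_e)\big)<+\infty$ for all $(x_s,y_s),(x_e,y_e)\in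 G$. $c$-antiderivative: a function $f\colon G\to\mathbb{R}$ is a $c$-antiderivative of $G$ if $c(x,y)-c(u,y)\le f(x,y)-f(u,v)$ for all $(x,y),(u,v)\in G$. *)

theory Defs
  imports "HOL-Library.Extended_Real" "HOL-Library.FuncSet"
begin

definition cost_domain :: "'a set \<Rightarrow> 'b set \<Rightarrow> ('a \<times> 'b \<Rightarrow> ereal) \<Rightarrow> ('a \<times> 'b) set" where
  "cost_domain X Y c = {z \<in> X \<times> Y. c z < \<infinity>}"

(* The sequence (x_k, y_k), 1 <= k <= N + 1, is the list p of length N + 1, with p ! k
   in the place of (x_(k+1), y_(k+1)); thus N = length p - 1 and N >= 1 says that p
   has at least two entries. *)
definition is_path ::
  "('a \<times> 'b \<Rightarrow> ereal) \<Rightarrow> ('a \<times> 'b) set \<Rightarrow> 'a \<times> 'b \<Rightarrow> 'a \<times> 'b \<Rightarrow> ('a \<times> 'b) list \<Rightarrow> bool" where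
  "is_path c G s e p \<longleftrightarrow>
     2 \<le> length p \<and> set p \<subseteq> G \<and> hd p = s \<and> last p = e \<and>
     (\<forall>k < length p - 1. c (fst (p ! Suc k), snd (p ! k)) < \<infinity>)"

definition inner_variation :: "('a \<times> 'b \<Rightarrow> ereal) \<Rightarrow> ('a \<times> 'b) list \<Rightarrow> ereal" where
  "inner_variation c p =
     (\<Sum>k < length p - 1. c (fst (p ! k), snd (p ! k)) - c (fst (p ! Suc k), snd (p ! k)))"

(* The supremum is taken in the complete lattice ereal, where Sup {} = - \<infinity>. *)
definition max_inner_variation ::
  "('a \<times> 'b \<Rightarrow> ereal) \<Rightarrow> ('a \<times> 'b) set \<Rightarrow> 'a \<times> 'b \<Rightarrow> 'a \<times> 'b \<Rightarrow> ereal" where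
  "max_inner_variation c G s e = (SUP p \<in> {p. is_path c G s e p}. inner_variation c p)"

definition c_path_bounded :: "('a \<times> 'b \<Rightarrow> ereal) \<Rightarrow> ('a \<times> 'b) set \<Rightarrow> bool" where
  "c_path_bounded c G \<longleftrightarrow> (\<forall>s \<in> G. \<forall>e \<in> G. max_inner_variation c G s e < \<infinity>)"

(* Antiderivatives are real-valued on G. They are encoded as extended-real functions
   required to take real values on G, so that the property applies directly to functions
   given by suprema. The left-hand side of the inequality is - \<infinity> if c (u, y) = \<infinity>. *)
definition c_antiderivative ::
  "('a \<times> 'b \<Rightarrow> ereal) \<Rightarrow> ('a \<times> 'b) set \<Rightarrow> ('a \<times> 'b \<Rightarrow> ereal) \<Rightarrow> bool" where
  "c_antiderivative c G f \<longleftrightarrow>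
     f \<in> G \<rightarrow> range ereal \<and>
     (\<forall>(x, y) \<in> G. \<forall>(u, v) \<in> G. c (x, y) - c (u, y) \<le> f (x, y) - f (u, v))"

end

theory Submission
  imports Defs
begin

text \<open>
  Write \<open>f z = (SUP e \<in> \<Omega>. F z e)\<close> with \<open>F\<close> the maximal inner variation. If \<open>c (u, y) < \<infinity>\<close>, then a path
  from \<open>(u, v)\<close> to \<open>e\<close> becomes a path from \<open>(x, y)\<close> to \<open>e\<close> when \<open>(x, y)\<close> is put in front of it, and
  its inner variation grows by the single term \<open>c (x, y) - c (u, y)\<close>. The end point is untouched,
  so passing to suprema, first over paths and then over \<open>e \<in> \<Omega>\<close>, yields
  \<open>f (u, v) \<le> f (x, y) - (c (x, y) - c (u, y))\<close>, which is the antiderivative inequality once \<open>f\<close> is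
  known to be real-valued. If \<open>c (u, y) = \<infinity>\<close>, the left-hand side of that inequality is \<open>-\<infinity>\<close>.

  Real-valuedness uses the two hypotheses on \<open>G\<close> and \<open>\<Omega>\<close> separately. Path boundedness makes each
  \<open>F z e\<close> smaller than \<open>\<infinity>\<close>, and a supremum of finitely many such values stays below \<open>\<infinity>\<close>. The
  existence of one path from \<open>z\<close> into \<open>\<Omega>\<close> keeps \<open>f z\<close> above \<open>-\<infinity>\<close>, since the inner variation of a
  path is a finite sum of differences of real numbers.
\<close>

lemma cost_real:
  assumes "c \<in> X \<times> Y \<rightarrow> {-\<infinity><..}" and "z \<in> X \<times> Y" and "c z < \<infinity>"
  obtains r where "c z = ereal r"
  using assms by (cases "c z") (auto dest: funcset_mem)

lemma is_path_Cons:
  assumes "is_path c G s e p" and "z \<in> G" and "c (fst s, snd z) < \<infinity>"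
  shows "is_path c G z e (z # p)"
  using assms by (cases p) (auto simp: is_path_def nth_Cons split: nat.split)

lemma inner_variation_Cons:
  assumes "p \<noteq> []"
  shows "inner_variation c (z # p) = (c z - c (fst (hd p), snd z)) + inner_variation c p"
  using assms
  by (cases p) (simp_all add: inner_variation_def sum.lessThan_Suc_shift del: sum.lessThan_Suc)

text \<open>
  A path keeps both kinds of cost away from \<open>\<infinity>\<close>: the values \<open>c (x\<^sub>k, y\<^sub>k)\<close> because its points lie in the
  domain of \<open>c\<close>, and the values \<open>c (x\<^sub>k\<^sub>+\<^sub>1, y\<^sub>k)\<close> by the defining condition on paths.
\<close>

lemma inner_variation_gt_minus_infinity:
  assumes c: "c \<in> X \<times> Y \<rightarrow> {-\<infinity><..}" and G: "G \<subseteq> cost_domain X Y c"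
    and p: "is_path c G s e p"
  shows "- \<infinity> < inner_variation c p"
proof -
  have "\<exists>r. c (fst (p ! k), snd (p ! k)) - c (fst (p ! Suc k), snd (p ! k)) = ereal r"
    if k: "k < length p - 1" for k
  proof -
    have mem: "p ! k \<in> cost_domain X Y c" "p ! Suc k \<in> cost_domain X Y c"
      using p k by (auto simp: is_path_def intro!: subsetD[OF G] subsetD[of "set p" G])
    obtain a where "c (p ! k) = ereal a"
      using cost_real[OF c, of "p ! k"] mem by (auto simp: cost_domain_def)
    moreover obtain b where "c (fst (p ! Suc k), snd (p ! k)) = ereal b"
      using cost_real[OF c, of "(fst (p ! Suc k), snd (p ! k))"] mem p k
      by (auto simp: cost_domain_def is_path_def mem_Times_iff)
    ultimately show ?thesis by simp
  qed
  then obtain r where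
    "\<And>k. k < length p - 1 \<Longrightarrow> c (fst (p ! k), snd (p ! k)) - c (fst (p ! Suc k), snd (p ! k)) = ereal (r k)"
    by metis
  then have "inner_variation c p = ereal (\<Sum>k<length p - 1. r k)"
    by (simp add: inner_variation_def)
  then show ?thesis by simp
qed

text \<open>
  Prepending a point to a path is the only construction behind the antiderivative inequality.
  Moving the real jump term to the right turns the left-hand side into a bare supremum over paths,
  so it suffices to bound each path, and an empty set of paths needs no separate case.
\<close>

lemma max_inner_variation_prepend:
  assumes z: "z \<in> G" and lt: "c (fst s, snd z) < \<infinity>" and a: "c z - c (fst s, snd z) = ereal a"
  shows "max_inner_variation c G s e \<le> max_inner_variation c G z e - ereal a"
  unfolding max_inner_variation_def[of c G s e]
proof (rule SUP_least)
  fix p assume "p \<in> {p. is_path c G s e p}"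
  then have p: "is_path c G s e p" by simp
  then have "hd p = s" and ne: "p \<noteq> []" by (auto simp: is_path_def)
  then have "inner_variation c (z # p) = ereal a + inner_variation c p"
    using inner_variation_Cons[OF ne, of c z] a by simp
  moreover have "inner_variation c (z # p) \<le> max_inner_variation c G z e"
    unfolding max_inner_variation_def using is_path_Cons[of c G s e p z] p z lt by (intro SUP_upper) simp
  ultimately show "inner_variation c p \<le> max_inner_variation c G z e - ereal a"
    by (simp add: ereal_le_minus add.commute)
qed

theorem theorem3p3:
  fixes X :: "'a set" and Y :: "'b set"
    and c :: "'a \<times> 'b \<Rightarrow> ereal"
    and G \<Omega> :: "('a \<times> 'b) set"
  assumes "X \<noteq> {}" and "Y \<noteq> {}"
    and "c \<in> X \<times> Y \<rightarrow> {-\<infinity><..}"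
    and "cost_domain X Y c \<noteq> {}"
    and "G \<subseteq> cost_domain X Y c" and "G \<noteq> {}"
    and "c_path_bounded c G"
    and "\<Omega> \<subseteq> G" and "\<Omega> \<noteq> {}" and "finite \<Omega>"
    and "\<forall>z \<in> G. \<exists>e \<in> \<Omega>. \<exists>p. is_path c G z e p"
  shows "c_antiderivative c G (\<lambda>z. SUP e \<in> \<Omega>. max_inner_variation c G z e)"
proof -
  define f where "f = (\<lambda>z. SUP e \<in> \<Omega>. max_inner_variation c G z e)"
  have f_real: "\<exists>r. f z = ereal r" if z: "z \<in> G" for z
  proof -
    have "f z < \<infinity>"
      unfolding f_def using assms(7-10) z
      by (subst finite_Sup_less_iff) (auto simp: c_path_bounded_def)
    moreover have "- \<infinity> < f z"
    proof -
      obtain e p where e: "e \<in> \<Omega>" and p: "is_path c G z e p"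
        using assms(11) z by blast
      have "- \<infinity> < inner_variation c p"
        by (rule inner_variation_gt_minus_infinity[OF assms(3,5) p])
      also have "\<dots> \<le> max_inner_variation c G z e"
        unfolding max_inner_variation_def using p by (intro SUP_upper) simp
      also have "\<dots> \<le> f z"
        unfolding f_def using e by (rule SUP_upper)
      finally show ?thesis .
    qed
    ultimately show ?thesis by (cases "f z") auto
  qed
  have "c (x, y) - c (u, y) \<le> f (x, y) - f (u, v)"
    if xy: "(x, y) \<in> G" and uv: "(u, v) \<in> G" for x y u v
  proof -
    have mem: "(x, y) \<in> X \<times> Y" "(u, y) \<in> X \<times> Y" "c (x, y) < \<infinity>"
      using xy uv assms(5) by (auto simp: cost_domain_def)
    obtain b where b: "c (x, y) = ereal b"
      using cost_real[OF assms(3) mem(1,3)] .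
    show ?thesis
    proof (cases "c (u, y) = \<infinity>")
      case True
      then show ?thesis by (simp add: b)
    next
      case False
      then have lt: "c (u, y) < \<infinity>" by simp
      obtain d where d: "c (u, y) = ereal d"
        using cost_real[OF assms(3) mem(2) lt] .
      have "f (u, v) \<le> f (x, y) - ereal (b - d)"
        unfolding f_def
      proof (rule SUP_least)
        fix e assume e: "e \<in> \<Omega>"
        have "max_inner_variation c G (u, v) e \<le> max_inner_variation c G (x, y) e - ereal (b - d)"
          by (rule max_inner_variation_prepend) (use xy lt b d in simp_all)
        also have "\<dots> \<le> (SUP e \<in> \<Omega>. max_inner_variation c G (x, y) e) - ereal (b - d)"
          using e by (intro ereal_minus_mono SUP_upper) simp_all
        finally show "max_inner_variation c G (u, v) e \<le> \<dots>" .
      qed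
      moreover obtain r where "f (x, y) = ereal r" using f_real xy by blast
      moreover obtain t where "f (u, v) = ereal t" using f_real uv by blast
      ultimately show ?thesis by (simp add: b d)
    qed
  qed
  then show ?thesis
    using f_real unfolding c_antiderivative_def f_def[symmetric] by fastforce
qed

end
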